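(* Let $n\ge1$. (i) $R_n(13/2/4)$ is the set of all restricted growth functions $w$ of length $n$, with largest letter $m$, satisfying one of the following: (A) $m\le2$; or (B) $m\ge3$ and $w=uv$ where $u$ is weakly increasing, and $v$ begins at the first $m$ of $w$ and consists of letters $m$ and $m-1$ only, in any order (after the initial $m$; the letter $m-1$ need not occur in $v$); or (C) $m\ge3$ and $w=uv$ where $u$ is weakly increasing, and $v$ begins at the first $m$ of $w$ and consists of a block of $m$s followed by a block of $z$s for some letter $z<m-1$. (ii) $$\#\Pi_n(13/2/4)=2^{n-1}+\sum_{m=3}^n\binom{n-1}{n-m}+\sum_{m=3}^{n-1}\ \sum_{k=m-1}^{n-2}\binom{k-1}{k-m+1}\Big[(2^{\,n-k-1}-1)+(m-2)(n-k-1)\Big],$$ where empty sums are $0$.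
   Context: A set partition $\sigma$ of $[n]=\{1,\dots,n\}$ is written $\sigma=B_1/B_2/\dots/B_m$ with blocks ordered so that $\min B_1<\dots<\min B_m$. For $A\subseteq[n]$, the subpartition $A\cap\sigma$ is the set partition of $A$ formed by the nonempty sets $A\cap B_i$; it is standardized by replacing its smallest element by $1$, the next smallest by $2$, and so on. $\sigma$ contains a pattern $\pi$ (a set partition of some $[k]$) if some subpartition of $\sigma$ standardizes to $\pi$; otherwise $\sigma$ avoids $\pi$. $\Pi_n(\pi)$ is the set of set partitions of $[n]$ avoiding $\pi$. A restricted growth function (RGF) of length $n$ is a word $w=w_1\cdots w_n$ of positive integers with $w_1=1$ and $w_i\le 1+\max\{w_1,\dots,w_{i-1}\}$ for $i\ge2$. To $\sigma=B_1/\dots/B_m$ corresponds the RGF $w(\sigma)$ with $w_i=j$ if $i\in B_j$. $R_n(\pi)=\{w(\sigma):\sigma\in\Pi_n(\pi)\}$. A block of a letter is a run of consecutive copies of it. The pattern $13/2/4$ is the set partition $\{1,3\},\{2\},\{4\}$ of $[4]$. *)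

theory Defs
  imports Main "HOL-Library.Disjoint_Sets"
begin

text \<open>Set partitions of \<open>[n]\<close> are values \<open>\<sigma>\<close> with \<^term>\<open>partition_on {1..n} \<sigma>\<close>.\<close>

definition subpartition :: "nat set \<Rightarrow> nat set set \<Rightarrow> nat set set" where
  "subpartition A \<sigma> = (\<lambda>B. A \<inter> B) ` \<sigma> - {{}}"

text \<open>For finite \<open>A\<close>, \<^term>\<open>card {b \<in> A. b \<le> a}\<close> is the rank of \<open>a \<in> A\<close>: it is \<open>1\<close> for the
  smallest element of \<open>A\<close>, \<open>2\<close> for the next smallest, and so on.\<close>

definition standardize :: "nat set set \<Rightarrow> nat set set" where
  "standardize \<tau> = (\<lambda>B. (\<lambda>a. card {b \<in> \<Union>\<tau>. b \<le> a}) ` B) ` \<tau>"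

definition contains_pattern :: "nat set set \<Rightarrow> nat set set \<Rightarrow> bool" where
  "contains_pattern \<sigma> \<pi> \<longleftrightarrow> (\<exists>A \<subseteq> \<Union>\<sigma>. standardize (subpartition A \<sigma>) = \<pi>)"

definition avoiders :: "nat \<Rightarrow> nat set set \<Rightarrow> nat set set set" where
  "avoiders n \<pi> = {\<sigma>. partition_on {1..n} \<sigma> \<and> \<not> contains_pattern \<sigma> \<pi>}"

text \<open>The first letter is constrained only for nonempty words; the bound \<^term>\<open>1 \<le> x\<close> says
  that letters are positive.  List positions count from \<open>0\<close>.\<close>

definition is_rgf :: "nat list \<Rightarrow> bool" where
  "is_rgf w \<longleftrightarrow> (\<forall>x \<in> set w. 1 \<le> x) \<and> (w \<noteq> [] \<longrightarrow> w ! 0 = 1) \<and>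
     (\<forall>i. 0 < i \<and> i < length w \<longrightarrow> w ! i \<le> 1 + Max (set (take i w)))"

text \<open>The list \<open>[B\<^sub>1, \<dots>, B\<^sub>m]\<close> of blocks with increasing minima; as list positions count
  from \<open>0\<close>, the block \<open>B\<^sub>j\<close> is \<open>block_list \<sigma> ! (j - 1)\<close>.\<close>

definition block_list :: "nat set set \<Rightarrow> nat set list" where
  "block_list \<sigma> = sorted_key_list_of_set Min \<sigma>"

definition rgf_of :: "nat \<Rightarrow> nat set set \<Rightarrow> nat list" where
  "rgf_of n \<sigma> = map (\<lambda>i. THE j. j \<in> {1..card \<sigma>} \<and> i \<in> block_list \<sigma> ! (j - 1)) [1..<Suc n]"

definition avoider_rgfs :: "nat \<Rightarrow> nat set set \<Rightarrow> nat list set" where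
  "avoider_rgfs n \<pi> = rgf_of n ` avoiders n \<pi>"

definition pattern_13_2_4 :: "nat set set" where
  "pattern_13_2_4 = {{1, 3}, {2}, {4}}"

end

theory Submission
  imports Defs "HOL-Library.Sublist"
begin

text \<open>A set partition contains \<open>13/2/4\<close> iff its word has a subword \<open>abac\<close> with three different
  letters, and a restricted growth function is determined by its equality pattern, so the
  problem is one about \<open>abac\<close>-avoiding words.  Let \<open>m \<ge> 3\<close> be the largest letter and split the
  word before its first \<open>m\<close>.  A descent in the first part \<open>u\<close> would give \<open>aba\<close>, which the \<open>m\<close>
  completes to the pattern; so \<open>u\<close> is weakly increasing with letters \<open>1, \<dots>, m - 1\<close>.  If a letter
  \<open>z < m - 1\<close> occurs after the first \<open>m\<close>, then \<open>z (m - 1) z\<close> and \<open>z m z\<close> force everything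
  after it to be \<open>z\<close>, and any \<open>y\<close> with \<open>z \<noteq> y < m\<close> before it would give \<open>y m y z\<close>.

  For the count, the words \<open>u\<close> of length \<open>k\<close> number \<open>(k - 1) choose (m - 2)\<close>, and the
  continuations consisting of \<open>m\<close> only are summed by the hockey-stick identity.\<close>

section \<open>Restricted growth functions\<close>

lemma is_rgf_Nil [simp]: "is_rgf []"
  by (simp add: is_rgf_def)

text \<open>The condition at a position only looks at the prefix before it, so appending a letter
  adds exactly one condition. The empty word is kept apart because \<open>Max {}\<close> is
  unspecified.\<close>

lemma is_rgf_snoc_Max:
  "is_rgf (w @ [x]) \<longleftrightarrow> is_rgf w \<and> 1 \<le> x \<and> (if w = [] then x = 1 else x \<le> 1 + Max (set w))"
proof -
  have "(\<forall>i. 0 < i \<and> i < length (w @ [x]) \<longrightarrow> (w @ [x]) ! i \<le> 1 + Max (set (take i (w @ [x])))) \<longleftrightarrow>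
    (\<forall>i. 0 < i \<and> i < length w \<longrightarrow> w ! i \<le> 1 + Max (set (take i w))) \<and>
    (w \<noteq> [] \<longrightarrow> x \<le> 1 + Max (set w))"
    by (auto simp: nth_append less_Suc_eq)
  then show ?thesis
    unfolding is_rgf_def by (auto simp: nth_append)
qed

text \<open>A new letter exceeds the previous maximum by at most one, so no value is ever skipped.
  Hence the number of letters and the largest letter agree, and the former also makes sense for the
  empty word.\<close>

lemma set_rgf: "is_rgf w \<Longrightarrow> set w = {1..card (set w)}"
proof (induction w rule: rev_induct)
  case (snoc x w)
  define c where "c = card (set w)"
  have w: "is_rgf w" and x: "1 \<le> x" and b: "if w = [] then x = 1 else x \<le> 1 + Max (set w)"
    using snoc.prems by (auto simp: is_rgf_snoc_Max)
  have s: "set w = {1..c}" using snoc.IH[OF w] by (simp add: c_def)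
  have "x \<le> Suc c"
  proof (cases "w = []")
    case False
    then have "c \<ge> 1" using s by (cases c) auto
    then have "Max (set w) = c" using s by (simp add: Max_eq_iff)
    then show ?thesis using b False by simp
  qed (use b in simp)
  then have "set (w @ [x]) = {1..max c x}"
    unfolding set_append s using x by (intro set_eqI) (simp, linarith)
  moreover from this have "card (set (w @ [x])) = max c x" by (simp del: set_append)
  ultimately show ?case by (simp only:)
qed simp

lemma mem_rgf: "is_rgf w \<Longrightarrow> x \<in> set w \<longleftrightarrow> 1 \<le> x \<and> x \<le> card (set w)"
  using set_rgf atLeastAtMost_iff by blast

lemma Max_rgf: "is_rgf w \<Longrightarrow> w \<noteq> [] \<Longrightarrow> Max (set w) = card (set w)"
  by (intro Max_eqI) (auto simp: mem_rgf Suc_le_eq card_gt_0_iff)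

text \<open>With \<open>card\<close> in place of \<open>Max\<close> the empty word is no exception:
  the bound becomes \<open>x \<le> 1\<close>. The inductions below on the last letter use this
  form.\<close>

lemma is_rgf_snoc: "is_rgf (w @ [x]) \<longleftrightarrow> is_rgf w \<and> 1 \<le> x \<and> x \<le> Suc (card (set w))"
  using Max_rgf[of w] by (auto simp: is_rgf_snoc_Max)

lemma is_rgf_appendD: "is_rgf (u @ v) \<Longrightarrow> is_rgf u"
  by (induction v rule: rev_induct) (simp_all flip: append_assoc add: is_rgf_snoc)

lemma is_rgf_appendI:
  "is_rgf u \<Longrightarrow> set v \<subseteq> {1..card (set u)} \<Longrightarrow> is_rgf (u @ v)"
proof (induction v rule: rev_induct)
  case (snoc x v)
  have "card (set u) \<le> card (set (u @ v))" by (intro card_mono) auto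
  with snoc show ?case by (simp flip: append_assoc add: is_rgf_snoc)
qed simp

lemma rgf_eqI_kernel:
  assumes "is_rgf w" "is_rgf w'" "length w = length w'"
    and "\<And>i j. i < length w \<Longrightarrow> j < length w \<Longrightarrow> w ! i = w ! j \<longleftrightarrow> w' ! i = w' ! j"
  shows "w = w'"
  using assms
proof (induction w arbitrary: w' rule: rev_induct)
  case (snoc x v)
  obtain v' x' where w': "w' = v' @ [x']"
    using snoc.prems(3) by (cases w' rule: rev_exhaust) auto
  have len: "length v = length v'" using snoc.prems(3) w' by simp
  have ker: "v ! i = v ! j \<longleftrightarrow> v' ! i = v' ! j" if "i < length v" "j < length v" for i j
    using snoc.prems(4)[of i j] that len by (simp add: w' nth_append)
  have v: "v = v'"
    using snoc.prems(1,2) len ker by (intro snoc.IH) (auto simp: w' is_rgf_snoc)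
  have last: "v ! i = x \<longleftrightarrow> v ! i = x'" if "i < length v" for i
    using snoc.prems(4)[of i "length v"] that v by (simp add: w' nth_append)
  have "x = x'"
  proof (cases "x \<in> set v \<or> x' \<in> set v")
    case True
    then show ?thesis using last by (metis in_set_conv_nth)
  next
    case False
    then have "x = Suc (card (set v))" "x' = Suc (card (set v))"
      using snoc.prems(1,2) mem_rgf[of v] unfolding w' v[symmetric]
      by (simp_all add: is_rgf_snoc)
    then show ?thesis by simp
  qed
  then show ?case using v w' by blast
qed simp

section \<open>Set partitions and their words\<close>

text \<open>Two blocks with the same minimum share that element. Injectivity is what makes sorting
  the blocks by \<open>Min\<close> well behaved.\<close>

lemma partition_on_inj_on_Min:
  fixes \<sigma> :: "nat set set"
  assumes "partition_on A \<sigma>" "finite A"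
  shows "inj_on Min \<sigma>"
proof (rule inj_onI)
  fix B C assume *: "B \<in> \<sigma>" "C \<in> \<sigma>" "Min B = Min C"
  have "finite B \<and> B \<noteq> {}" "finite C \<and> C \<noteq> {}"
    using * assms by (auto simp: partition_on_def intro: finite_subset)
  then have "Min B \<in> B \<inter> C" using * by (metis IntI Min_in)
  then show "B = C" using * partition_onD2[OF assms(1)] by (auto simp: disjoint_def)
qed

text \<open>The facts are those of the locale \<open>folding_insort_key\<close>, with
  \<open>A\<close> itself taken as the carrier on which the key is injective.\<close>

lemma (in linorder) sorted_key_list_of_set_props:
  assumes "inj_on f A" "finite A"
  shows "set (sorted_key_list_of_set f A) = A" "length (sorted_key_list_of_set f A) = card A"
    "distinct (sorted_key_list_of_set f A)" "sorted_wrt (<) (map f (sorted_key_list_of_set f A))"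
proof -
  interpret folding_insort_key "(\<le>)" "(<)" A f
    by unfold_locales (rule assms(1))
  show "set (sorted_key_list_of_set f A) = A" "length (sorted_key_list_of_set f A) = card A"
    "distinct (sorted_key_list_of_set f A)" "sorted_wrt (<) (map f (sorted_key_list_of_set f A))"
    using assms(2) distinct_if_distinct_map[OF distinct_sorted_key_list_of_set] by simp_all
qed

lemma block_list:
  assumes "partition_on {1..n} \<sigma>"
  shows "set (block_list \<sigma>) = \<sigma>" "length (block_list \<sigma>) = card \<sigma>" "distinct (block_list \<sigma>)"
    "sorted_wrt (<) (map Min (block_list \<sigma>))"
proof -
  have "finite \<sigma>" using assms by (meson finite_atLeastAtMost finite_elements)
  note * = sorted_key_list_of_set_props
    [OF partition_on_inj_on_Min[OF assms finite_atLeastAtMost] this, folded block_list_def]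
  show "set (block_list \<sigma>) = \<sigma>" "length (block_list \<sigma>) = card \<sigma>" "distinct (block_list \<sigma>)"
    "sorted_wrt (<) (map Min (block_list \<sigma>))"
    by (fact *)+
qed

lemma length_rgf_of [simp]: "length (rgf_of n \<sigma>) = n"
  by (simp add: rgf_of_def)

context
  fixes n :: nat and \<sigma> :: "nat set set"
  assumes part: "partition_on {1..n} \<sigma>"
begin

lemma block_list_nth_mem: "1 \<le> j \<Longrightarrow> j \<le> card \<sigma> \<Longrightarrow> block_list \<sigma> ! (j - 1) \<in> \<sigma>"
  using block_list(1,2)[OF part] nth_mem[of "j - 1" "block_list \<sigma>"] by simp

text \<open>The description in \<open>rgf_of\<close> is proper: disjointness determines the block of
  an element, and distinctness of \<open>block_list\<close> determines its index. List position
  \<open>i\<close> stands for the element \<open>Suc i\<close>.\<close>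

lemma rgf_of_in_block:
  assumes "i < n"
  shows "1 \<le> rgf_of n \<sigma> ! i" "rgf_of n \<sigma> ! i \<le> card \<sigma>"
    "Suc i \<in> block_list \<sigma> ! (rgf_of n \<sigma> ! i - 1)"
proof -
  let ?P = "\<lambda>j. j \<in> {1..card \<sigma>} \<and> Suc i \<in> block_list \<sigma> ! (j - 1)"
  note bl = block_list[OF part]
  have "Suc i \<in> \<Union>\<sigma>" using partition_onD1[OF part] assms by auto
  then obtain B where B: "B \<in> \<sigma>" "Suc i \<in> B" by blast
  then obtain k where k: "k < card \<sigma>" "block_list \<sigma> ! k = B"
    using bl(1,2) by (metis in_set_conv_nth)
  have "\<exists>!j. ?P j"
  proof
    show "?P (Suc k)" using k B by simp
    fix j assume j: "?P j"
    then have "block_list \<sigma> ! (j - 1) \<in> \<sigma>"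
      using block_list_nth_mem by simp
    then have "block_list \<sigma> ! (j - 1) = B"
      using B j partition_onD2[OF part] by (auto simp: disjoint_def)
    then have "j - 1 = k" using k j bl(2,3) nth_eq_iff_index_eq[of "block_list \<sigma>" "j - 1" k] by auto
    then show "j = Suc k" using j by auto
  qed
  then have "?P (THE j. ?P j)" by (rule theI')
  moreover have "rgf_of n \<sigma> ! i = (THE j. ?P j)" using assms by (simp add: rgf_of_def del: upt_Suc)
  ultimately show "1 \<le> rgf_of n \<sigma> ! i" "rgf_of n \<sigma> ! i \<le> card \<sigma>"
    "Suc i \<in> block_list \<sigma> ! (rgf_of n \<sigma> ! i - 1)" by auto
qed

lemma rgf_of_eqI:
  assumes "i < n" "1 \<le> j" "j \<le> card \<sigma>" "Suc i \<in> block_list \<sigma> ! (j - 1)"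
  shows "rgf_of n \<sigma> ! i = j"
proof -
  note r = rgf_of_in_block[OF assms(1)]
  have "block_list \<sigma> ! (j - 1) = block_list \<sigma> ! (rgf_of n \<sigma> ! i - 1)"
    using block_list_nth_mem[OF assms(2,3)] block_list_nth_mem[OF r(1,2)] assms(4) r(3)
      partition_onD2[OF part] by (auto simp: disjoint_def)
  then have "j - 1 = rgf_of n \<sigma> ! i - 1"
    using block_list(2,3)[OF part] assms(2,3) r(1,2) by (simp add: nth_eq_iff_index_eq)
  then show ?thesis using assms(2) r(1) by simp
qed

text \<open>This translates between words and partitions: injectivity, surjectivity and pattern
  containment are all reduced to it.\<close>

lemma rgf_of_kernel:
  assumes "i < n" "j < n"
  shows "rgf_of n \<sigma> ! i = rgf_of n \<sigma> ! j \<longleftrightarrow> (\<exists>B\<in>\<sigma>. Suc i \<in> B \<and> Suc j \<in> B)"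
proof
  assume "rgf_of n \<sigma> ! i = rgf_of n \<sigma> ! j"
  then show "\<exists>B\<in>\<sigma>. Suc i \<in> B \<and> Suc j \<in> B"
    using rgf_of_in_block[OF assms(1)] rgf_of_in_block[OF assms(2)] block_list_nth_mem by metis
next
  assume "\<exists>B\<in>\<sigma>. Suc i \<in> B \<and> Suc j \<in> B"
  then obtain B where B: "B \<in> \<sigma>" "Suc i \<in> B" "Suc j \<in> B" by blast
  note r = rgf_of_in_block[OF assms(1)]
  have "block_list \<sigma> ! (rgf_of n \<sigma> ! i - 1) = B"
    using block_list_nth_mem[OF r(1,2)] r(3) B partition_onD2[OF part] by (auto simp: disjoint_def)
  then show "rgf_of n \<sigma> ! i = rgf_of n \<sigma> ! j"
    using rgf_of_eqI[OF assms(2) r(1,2)] B by simp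
qed

text \<open>The minimum of the block before the one containing \<open>i\<close> is an earlier position
  carrying the preceding letter.\<close>

lemma rgf_of_pred_letter:
  assumes "i < n" "1 < rgf_of n \<sigma> ! i"
  shows "\<exists>i'<i. rgf_of n \<sigma> ! i' = rgf_of n \<sigma> ! i - 1"
proof -
  define j where "j = rgf_of n \<sigma> ! i"
  define B where "B = block_list \<sigma> ! (j - 2)"
  define C where "C = block_list \<sigma> ! (j - 1)"
  note r = rgf_of_in_block[OF assms(1), folded j_def]
  have j: "1 < j" using assms(2) by (simp add: j_def)
  have BC: "B \<in> \<sigma>" "C \<in> \<sigma>" "Suc i \<in> C"
    using block_list_nth_mem[of "j - 1"] block_list_nth_mem[of j] r j
    by (auto simp: B_def C_def numeral_2_eq_2)
  have sub: "B \<subseteq> {1..n}" "C \<subseteq> {1..n}" "B \<noteq> {}"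
    using BC part by (auto simp: partition_on_def)
  then have fin: "finite B" "finite C" by (auto intro: finite_subset)
  have "Min B < Min C"
    using block_list(2,4)[OF part] j r
    by (auto simp: B_def C_def sorted_wrt_iff_nth_less)
  also have "Min C \<le> Suc i" using fin BC by simp
  finally have lt: "Min B < Suc i" .
  have MB: "Min B \<in> B" using fin sub by simp
  then obtain i' where i': "Min B = Suc i'" using sub by (cases "Min B") auto
  have "rgf_of n \<sigma> ! i' = j - 1"
    using i' MB lt assms(1) j r by (intro rgf_of_eqI) (auto simp: B_def numeral_2_eq_2)
  then show ?thesis using i' lt j_def by auto
qed

lemma is_rgf_rgf_of: "is_rgf (rgf_of n \<sigma>)"
proof -
  let ?w = "rgf_of n \<sigma>"
  have "\<forall>x\<in>set ?w. 1 \<le> x"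
    using rgf_of_in_block(1) by (auto simp: in_set_conv_nth)
  moreover have "?w ! 0 = 1" if "?w \<noteq> []"
  proof -
    have "0 < n" using that by (metis length_greater_0_conv length_rgf_of)
    \<comment> \<open>A letter above 1 at position 0 would require an earlier position.\<close>
    then show ?thesis using rgf_of_pred_letter[of 0] rgf_of_in_block(1)[of 0] by force
  qed
  moreover have "?w ! i \<le> 1 + Max (set (take i ?w))" if i: "0 < i" "i < length ?w" for i
  proof (cases "1 < ?w ! i")
    case True
    \<comment> \<open>The preceding letter has already been used, so the maximum of the prefix is at
      least the current letter minus one.\<close>
    then obtain i' where "i' < i" "?w ! i' = ?w ! i - 1"
      using rgf_of_pred_letter[of i] i by auto
    moreover from this have "?w ! i' \<in> set (take i ?w)"
      using i by (metis in_set_conv_nth length_take min_less_iff_conj nth_take order_less_trans)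
    ultimately have "?w ! i - 1 \<le> Max (set (take i ?w))" by (simp add: Max_ge)
    then show ?thesis by simp
  qed auto
  ultimately show ?thesis by (auto simp: is_rgf_def)
qed

end

section \<open>The bijection between set partitions and restricted growth functions\<close>

lemma inj_on_rgf_of: "inj_on (rgf_of n) {\<sigma>. partition_on {1..n} \<sigma>}"
proof (rule inj_onI, clarify)
  \<comment> \<open>By symmetry one inclusion suffices. The block of an element \<open>b\<close>
    consists of all elements whose letter equals that of \<open>b\<close>, and this set depends only
    on the word.\<close>
  have sub: "\<sigma> \<subseteq> \<tau>" if p: "partition_on {1..n} \<sigma>" "partition_on {1..n} \<tau>"
    and e: "rgf_of n \<sigma> = rgf_of n \<tau>" for \<sigma> \<tau>
  proof
    fix B assume B: "B \<in> \<sigma>"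
    have BU: "B \<subseteq> {1..n}" "B \<noteq> {}" using B p(1) by (auto simp: partition_on_def)
    then obtain b where b: "b \<in> B" by blast
    then obtain i where i: "b = Suc i" "i < n" using BU by (cases b) auto
    obtain C where C: "C \<in> \<tau>" "b \<in> C" using b BU partition_onD1[OF p(2)] by blast
    have CU: "C \<subseteq> {1..n}" using C p(2) by (auto simp: partition_on_def)
    have mem: "x \<in> D \<longleftrightarrow> (\<exists>E\<in>\<rho>. b \<in> E \<and> x \<in> E)"
      if "partition_on {1..n} \<rho>" "D \<in> \<rho>" "b \<in> D" for x D \<rho>
      using that partition_onD2[OF that(1)] by (auto simp: disjoint_def)
    have "x \<in> B \<longleftrightarrow> x \<in> C" if "x \<in> {1..n}" for x
    proof -
      from that obtain j where j: "x = Suc j" "j < n" by (cases x) auto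
      show ?thesis
        using rgf_of_kernel[OF p(1) i(2) j(2)] rgf_of_kernel[OF p(2) i(2) j(2)] e
          mem[OF p(1) B b] mem[OF p(2) C] by (simp add: i j)
    qed
    then have "B = C" using BU CU by auto
    then show "B \<in> \<tau>" using C by simp
  qed
  fix \<sigma> \<tau> assume "partition_on {1..n} \<sigma>" "partition_on {1..n} \<tau>" "rgf_of n \<sigma> = rgf_of n \<tau>"
  then show "\<sigma> = \<tau>" using sub[of \<sigma> \<tau>] sub[of \<tau> \<sigma>] by simp
qed

text \<open>The blocks are the level sets of \<open>w\<close>. The word of this partition has the
  same equality pattern as \<open>w\<close>, and both are restricted growth functions, so they
  coincide.\<close>

lemma ex_partition_rgf_of:
  assumes "is_rgf w"
  shows "\<exists>\<sigma>. partition_on {1..length w} \<sigma> \<and> rgf_of (length w) \<sigma> = w"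
proof -
  let ?n = "length w"
  define \<sigma> where "\<sigma> = (\<lambda>x. {i \<in> {1..?n}. w ! (i - 1) = x}) ` set w"
  have part: "partition_on {1..?n} \<sigma>"
  proof (rule partition_onI)
    show "\<Union>\<sigma> = {1..?n}" by (auto simp: \<sigma>_def)
    show "disjnt p q" if "p \<in> \<sigma>" "q \<in> \<sigma>" "p \<noteq> q" for p q
      using that by (auto simp: \<sigma>_def disjnt_def)
    show "{} \<notin> \<sigma>"
    proof
      assume "{} \<in> \<sigma>"
      then obtain x where x: "x \<in> set w" "{i \<in> {1..?n}. w ! (i - 1) = x} = {}"
        by (auto simp: \<sigma>_def)
      then obtain i where "i < ?n" "w ! i = x" by (auto simp: in_set_conv_nth)
      then have "Suc i \<in> {i \<in> {1..?n}. w ! (i - 1) = x}" by simp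
      then show False using x(2) by blast
    qed
  qed
  have "rgf_of ?n \<sigma> = w"
  proof (rule rgf_eqI_kernel)
    fix i j assume "i < length (rgf_of ?n \<sigma>)" "j < length (rgf_of ?n \<sigma>)"
    then have ij: "i < ?n" "j < ?n" by simp_all
    show "rgf_of ?n \<sigma> ! i = rgf_of ?n \<sigma> ! j \<longleftrightarrow> w ! i = w ! j"
      unfolding rgf_of_kernel[OF part ij] using ij nth_mem[of i w] by (force simp: \<sigma>_def)
  qed (use is_rgf_rgf_of[OF part] assms in simp_all)
  then show ?thesis using part by blast
qed

section \<open>Subwords and patterns\<close>

lemma subseq_Cons_nth:
  "subseq (x # xs) w \<longleftrightarrow> (\<exists>i<length w. w ! i = x \<and> subseq xs (drop (Suc i) w))"
proof
  assume "subseq (x # xs) w"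
  then obtain us vs where "w = us @ x # vs" "subseq xs vs"
    by (blast dest: list_emb_ConsD)
  then show "\<exists>i<length w. w ! i = x \<and> subseq xs (drop (Suc i) w)"
    by (intro exI[of _ "length us"]) simp
next
  assume "\<exists>i<length w. w ! i = x \<and> subseq xs (drop (Suc i) w)"
  then obtain i where i: "i < length w" "w ! i = x" "subseq xs (drop (Suc i) w)" by blast
  then have "subseq (x # xs) (take i w @ w ! i # drop (Suc i) w)"
    by (intro subseq_drop_many) simp
  then show "subseq (x # xs) w" using i(1) by (simp add: id_take_nth_drop[symmetric])
qed

lemma subseq_four_nth:
  "subseq [a, b, c, d] w \<longleftrightarrow>
    (\<exists>i j k l. i < j \<and> j < k \<and> k < l \<and> l < length w \<and> w ! i = a \<and> w ! j = b \<and> w ! k = c \<and> w ! l = d)"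
  (is "?L \<longleftrightarrow> ?R")
proof
  assume ?L
  \<comment> \<open>Each index counts from just after the previous position, so the absolute
    positions are sums of successors.\<close>
  then obtain i j k l where *: "i < length w" "w ! i = a"
    "j < length (drop (Suc i) w)" "drop (Suc i) w ! j = b"
    "k < length (drop (Suc j) (drop (Suc i) w))" "drop (Suc j) (drop (Suc i) w) ! k = c"
    "l < length (drop (Suc k) (drop (Suc j) (drop (Suc i) w)))"
    "drop (Suc k) (drop (Suc j) (drop (Suc i) w)) ! l = d"
    unfolding subseq_Cons_nth by blast
  show ?R
    by (rule exI[of _ i], rule exI[of _ "Suc i + j"], rule exI[of _ "Suc i + Suc j + k"],
        rule exI[of _ "Suc i + Suc j + Suc k + l"]) (use * in \<open>simp add: add_ac\<close>)
next
  assume ?R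
  then obtain i j k l where *: "i < j" "j < k" "k < l" "l < length w"
    "w ! i = a" "w ! j = b" "w ! k = c" "w ! l = d" by blast
  have "subseq [w ! l] (drop (Suc k) w)"
    using * by (subst subseq_Cons_nth) (auto intro!: exI[of _ "l - Suc k"])
  then have "subseq [w ! k, w ! l] (drop (Suc j) w)"
    using * by (subst subseq_Cons_nth) (auto intro!: exI[of _ "k - Suc j"])
  then have "subseq [w ! j, w ! k, w ! l] (drop (Suc i) w)"
    using * by (subst subseq_Cons_nth) (auto intro!: exI[of _ "j - Suc i"])
  then show ?L
    using * by (subst subseq_Cons_nth) (auto intro!: exI[of _ i])
qed

section \<open>Ranks, standardization and the pattern in terms of blocks\<close>

definition rank :: "nat set \<Rightarrow> nat \<Rightarrow> nat" where
  "rank A a = card {b \<in> A. b \<le> a}"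

lemma rank_less_iff:
  assumes "finite A" "x \<in> A" "y \<in> A"
  shows "rank A x < rank A y \<longleftrightarrow> x < y"
proof -
  have less: "rank A x < rank A y" if xy: "x < y" "y \<in> A" for x y
    unfolding rank_def
  proof (rule psubset_card_mono)
    have "y \<in> {b \<in> A. b \<le> y}" "y \<notin> {b \<in> A. b \<le> x}" using xy by simp_all
    moreover have "{b \<in> A. b \<le> x} \<subseteq> {b \<in> A. b \<le> y}" using xy by auto
    ultimately show "{b \<in> A. b \<le> x} \<subset> {b \<in> A. b \<le> y}" by blast
  qed (use assms(1) in simp)
  show ?thesis
    using less[of x y] less[of y x] assms(2,3) by (cases x y rule: linorder_cases) auto
qed

lemma rank_eq_iff: "finite A \<Longrightarrow> x \<in> A \<Longrightarrow> y \<in> A \<Longrightarrow> rank A x = rank A y \<longleftrightarrow> x = y"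
  using rank_less_iff[of A x y] rank_less_iff[of A y x] by (metis less_irrefl linorder_neqE_nat)

text \<open>The ground set of the subpartition is all of \<open>A\<close>, so the relabelling in
  \<open>standardize\<close> is \<open>rank A\<close>, applied block by block.\<close>

lemma standardize_subpartition:
  assumes "A \<subseteq> \<Union>\<sigma>"
  shows "standardize (subpartition A \<sigma>) = image (rank A) ` (((\<inter>) A) ` \<sigma> - {{}})"
proof -
  have "\<Union>(subpartition A \<sigma>) = A" using assms unfolding subpartition_def by blast
  then show ?thesis unfolding standardize_def rank_def by (simp add: subpartition_def)
qed

text \<open>Ranks preserve order and are injective on \<open>A\<close>, so a copy of the pattern
  amounts to four elements in increasing order of which exactly the first and third share a
  block.\<close>

lemma contains_pattern_13_2_4_blocks:
  assumes part: "partition_on {1..n} \<sigma>"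
  shows "contains_pattern \<sigma> pattern_13_2_4 \<longleftrightarrow>
    (\<exists>i j k l. 1 \<le> i \<and> i < j \<and> j < k \<and> k < l \<and> l \<le> n \<and>
      (\<exists>B\<in>\<sigma>. i \<in> B \<and> k \<in> B) \<and> \<not> (\<exists>B\<in>\<sigma>. i \<in> B \<and> j \<in> B) \<and>
      \<not> (\<exists>B\<in>\<sigma>. i \<in> B \<and> l \<in> B) \<and> \<not> (\<exists>B\<in>\<sigma>. j \<in> B \<and> l \<in> B))"
  (is "_ \<longleftrightarrow> ?R")
proof
  assume "contains_pattern \<sigma> pattern_13_2_4"
  then obtain A where A: "A \<subseteq> \<Union>\<sigma>"
    and std: "image (rank A) ` (((\<inter>) A) ` \<sigma> - {{}}) = {{1, 3}, {2}, {4}}"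
    unfolding contains_pattern_def pattern_13_2_4_def using standardize_subpartition by metis
  have An: "A \<subseteq> {1..n}" using A partition_onD1[OF part] by simp
  then have fin: "finite A" by (auto intro: finite_subset)
  have "\<Union>(image (rank A) ` (((\<inter>) A) ` \<sigma> - {{}})) = rank A ` A"
    using A by blast
  \<comment> \<open>The blocks of the pattern cover 1 to 4, which yields one element of
    \<open>A\<close> for each rank.\<close>
  then have "rank A ` A = {1, 2, 3, 4}" unfolding std by auto
  then have ex: "\<exists>x\<in>A. rank A x = t" if "t \<in> {1, 2, 3, 4}" for t
    using that by (metis imageE)
  obtain i j k l where m: "i \<in> A" "j \<in> A" "k \<in> A" "l \<in> A"
    and r: "rank A i = 1" "rank A j = 2" "rank A k = 3" "rank A l = 4"
    using ex[of 1] ex[of 2] ex[of 3] ex[of 4] by auto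
  have same: "(\<exists>B\<in>\<sigma>. x \<in> B \<and> y \<in> B) \<longleftrightarrow> (\<exists>C\<in>{{1, 3}, {2}, {4}}. rank A x \<in> C \<and> rank A y \<in> C)"
    if xy: "x \<in> A" "y \<in> A" for x y
  proof
    assume "\<exists>B\<in>\<sigma>. x \<in> B \<and> y \<in> B"
    then obtain B where B: "B \<in> \<sigma>" "x \<in> B" "y \<in> B" by blast
    then have "rank A ` (A \<inter> B) \<in> image (rank A) ` (((\<inter>) A) ` \<sigma> - {{}})"
      using xy by blast
    then show "\<exists>C\<in>{{1, 3}, {2}, {4}}. rank A x \<in> C \<and> rank A y \<in> C"
      unfolding std using B xy by blast
  next
    assume "\<exists>C\<in>{{1, 3}, {2}, {4}}. rank A x \<in> C \<and> rank A y \<in> C"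
    then obtain C where C: "C \<in> {{1, 3}, {2}, {4}}" "rank A x \<in> C" "rank A y \<in> C" by blast
    obtain B where "B \<in> \<sigma>" "C = rank A ` (A \<inter> B)"
      using C(1) unfolding std[symmetric] by blast
    then show "\<exists>B\<in>\<sigma>. x \<in> B \<and> y \<in> B"
      using C(2,3) xy rank_eq_iff[OF fin] by auto
  qed
  have "i < j" "j < k" "k < l"
    using rank_less_iff[OF fin m(1,2)] rank_less_iff[OF fin m(2,3)] rank_less_iff[OF fin m(3,4)] r
    by simp_all
  moreover have "(\<exists>B\<in>\<sigma>. i \<in> B \<and> k \<in> B)" "\<not> (\<exists>B\<in>\<sigma>. i \<in> B \<and> j \<in> B)"
      "\<not> (\<exists>B\<in>\<sigma>. i \<in> B \<and> l \<in> B)" "\<not> (\<exists>B\<in>\<sigma>. j \<in> B \<and> l \<in> B)"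
    using m by (simp_all add: same r)
  moreover have "1 \<le> i" "l \<le> n" using m An by auto
  ultimately show ?R by blast
next
  assume ?R
  then obtain i j k l where *: "1 \<le> i \<and> i < j \<and> j < k \<and> k < l \<and> l \<le> n \<and>
      (\<exists>B\<in>\<sigma>. i \<in> B \<and> k \<in> B) \<and> \<not> (\<exists>B\<in>\<sigma>. i \<in> B \<and> j \<in> B) \<and>
      \<not> (\<exists>B\<in>\<sigma>. i \<in> B \<and> l \<in> B) \<and> \<not> (\<exists>B\<in>\<sigma>. j \<in> B \<and> l \<in> B)"
    by (elim exE) (rule that)
  then have ord: "1 \<le> i" "i < j" "j < k" "k < l" "l \<le> n"
    and ik: "\<exists>B\<in>\<sigma>. i \<in> B \<and> k \<in> B" and nij: "\<not> (\<exists>B\<in>\<sigma>. i \<in> B \<and> j \<in> B)"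
    and nil: "\<not> (\<exists>B\<in>\<sigma>. i \<in> B \<and> l \<in> B)" and njl: "\<not> (\<exists>B\<in>\<sigma>. j \<in> B \<and> l \<in> B)"
    by simp_all
  define A where "A = {i, j, k, l}"
  have "A \<subseteq> {1..n}" using ord by (auto simp: A_def)
  then have A: "A \<subseteq> \<Union>\<sigma>" using partition_onD1[OF part] by simp
  obtain B where B: "B \<in> \<sigma>" "i \<in> B" "k \<in> B" using ik by blast
  obtain C where C: "C \<in> \<sigma>" "j \<in> C" using A by (auto simp: A_def)
  obtain D where D: "D \<in> \<sigma>" "l \<in> D" using A by (auto simp: A_def)
  have disj: "X = Y" if "X \<in> \<sigma>" "Y \<in> \<sigma>" "x \<in> X" "x \<in> Y" for X Y x
    using that partition_onD2[OF part] by (auto simp: disjoint_def)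
  have AB: "A \<inter> B = {i, k}" using B nij nil by (auto simp: A_def)
  have AC: "A \<inter> C = {j}" using C nij njl disj[OF C(1) B(1)] B by (auto simp: A_def)
  have AD: "A \<inter> D = {l}" using D nil njl disj[OF D(1) B(1)] B by (auto simp: A_def)
  \<comment> \<open>Any block that meets \<open>A\<close> contains one of the four elements, hence
    is \<open>B\<close>, \<open>C\<close> or \<open>D\<close>.\<close>
  have "((\<inter>) A) ` \<sigma> - {{}} = {A \<inter> B, A \<inter> C, A \<inter> D}"
  proof
    show "{A \<inter> B, A \<inter> C, A \<inter> D} \<subseteq> ((\<inter>) A) ` \<sigma> - {{}}"
      using B(1) C(1) D(1) AB AC AD by auto
    show "((\<inter>) A) ` \<sigma> - {{}} \<subseteq> {A \<inter> B, A \<inter> C, A \<inter> D}"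
    proof
      fix Y assume "Y \<in> ((\<inter>) A) ` \<sigma> - {{}}"
      then obtain X x where X: "X \<in> \<sigma>" "Y = A \<inter> X" "x \<in> A" "x \<in> X" by auto
      then have "X = B \<or> X = C \<or> X = D"
        using disj[OF X(1) B(1)] disj[OF X(1) C(1)] disj[OF X(1) D(1)] B C D
        by (auto simp: A_def)
      then show "Y \<in> {A \<inter> B, A \<inter> C, A \<inter> D}" using X by blast
    qed
  qed
  then have s: "((\<inter>) A) ` \<sigma> - {{}} = {{i, k}, {j}, {l}}" using AB AC AD by simp
  have "{b \<in> A. b \<le> i} = {i}" "{b \<in> A. b \<le> j} = {i, j}" "{b \<in> A. b \<le> k} = {i, j, k}"
    "{b \<in> A. b \<le> l} = {i, j, k, l}"
    using ord by (auto simp: A_def)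
  then have "rank A i = 1" "rank A j = 2" "rank A k = 3" "rank A l = 4"
    using ord by (simp_all add: rank_def)
  then have "standardize (subpartition A \<sigma>) = pattern_13_2_4"
    unfolding standardize_subpartition[OF A] s pattern_13_2_4_def by simp
  then show "contains_pattern \<sigma> pattern_13_2_4"
    using A by (auto simp: contains_pattern_def)
qed

section \<open>Containment of the pattern read off the word\<close>

definition avoids_abac :: "'a list \<Rightarrow> bool" where
  "avoids_abac w \<longleftrightarrow> (\<forall>a b c. subseq [a, b, a, c] w \<longrightarrow> a = b \<or> a = c \<or> b = c)"

lemma not_avoids_abac_nth:
  "\<not> avoids_abac w \<longleftrightarrow> (\<exists>i j k l. i < j \<and> j < k \<and> k < l \<and> l < length w \<and>
    w ! i = w ! k \<and> w ! i \<noteq> w ! j \<and> w ! i \<noteq> w ! l \<and> w ! j \<noteq> w ! l)" (is "?L \<longleftrightarrow> ?R")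
proof
  assume ?L
  then obtain a b c where "subseq [a, b, a, c] w" and ne: "a \<noteq> b" "a \<noteq> c" "b \<noteq> c"
    unfolding avoids_abac_def by blast
  then obtain i j k l where *: "i < j" "j < k" "k < l" "l < length w"
    "w ! i = a" "w ! j = b" "w ! k = a" "w ! l = c"
    unfolding subseq_four_nth by blast
  show ?R
    by (rule exI[of _ i], rule exI[of _ j], rule exI[of _ k], rule exI[of _ l]) (use * ne in simp)
next
  assume ?R
  then obtain i j k l where *: "i < j" "j < k" "k < l" "l < length w"
    "w ! i = w ! k" "w ! i \<noteq> w ! j" "w ! i \<noteq> w ! l" "w ! j \<noteq> w ! l" by blast
  then have "subseq [w ! i, w ! j, w ! i, w ! l] w"
    unfolding subseq_four_nth by metis
  then show ?L using * unfolding avoids_abac_def by blast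
qed

text \<open>Written by positions, an occurrence of \<open>abac\<close> only asks which positions
  carry equal letters, and \<open>rgf_of_kernel\<close> turns this into the condition on blocks.
  What remains is the shift between positions from 0 and elements from 1.\<close>

lemma contains_pattern_13_2_4_iff:
  assumes part: "partition_on {1..n} \<sigma>"
  shows "contains_pattern \<sigma> pattern_13_2_4 \<longleftrightarrow> \<not> avoids_abac (rgf_of n \<sigma>)"
proof -
  let ?w = "rgf_of n \<sigma>"
  let ?same = "\<lambda>i j. \<exists>B\<in>\<sigma>. i \<in> B \<and> j \<in> B"
  have "\<not> avoids_abac ?w \<longleftrightarrow> (\<exists>i j k l. i < j \<and> j < k \<and> k < l \<and> l < n \<and>
    ?w ! i = ?w ! k \<and> ?w ! i \<noteq> ?w ! j \<and> ?w ! i \<noteq> ?w ! l \<and> ?w ! j \<noteq> ?w ! l)"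
    by (simp add: not_avoids_abac_nth)
  also have "\<dots> \<longleftrightarrow> (\<exists>i j k l. i < j \<and> j < k \<and> k < l \<and> l < n \<and> ?same (Suc i) (Suc k) \<and>
    \<not> ?same (Suc i) (Suc j) \<and> \<not> ?same (Suc i) (Suc l) \<and> \<not> ?same (Suc j) (Suc l))"
    by (intro iff_exI conj_cong refl) (simp_all add: rgf_of_kernel[OF part])
  also have "\<dots> \<longleftrightarrow> (\<exists>i j k l. 1 \<le> i \<and> i < j \<and> j < k \<and> k < l \<and> l \<le> n \<and> ?same i k \<and>
    \<not> ?same i j \<and> \<not> ?same i l \<and> \<not> ?same j l)" (is "?L \<longleftrightarrow> ?R")
  proof
    assume ?L
    then obtain i j k l where "i < j \<and> j < k \<and> k < l \<and> l < n \<and> ?same (Suc i) (Suc k) \<and>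
      \<not> ?same (Suc i) (Suc j) \<and> \<not> ?same (Suc i) (Suc l) \<and> \<not> ?same (Suc j) (Suc l)"
      by (elim exE) (rule that)
    then show ?R
      by (intro exI[of _ "Suc i"] exI[of _ "Suc j"] exI[of _ "Suc k"] exI[of _ "Suc l"]) simp
  next
    assume ?R
    then obtain i j k l where "1 \<le> i \<and> i < j \<and> j < k \<and> k < l \<and> l \<le> n \<and> ?same i k \<and>
      \<not> ?same i j \<and> \<not> ?same i l \<and> \<not> ?same j l"
      by (elim exE) (rule that)
    then show ?L
      by (intro exI[of _ "i - 1"] exI[of _ "j - 1"] exI[of _ "k - 1"] exI[of _ "l - 1"])
        (simp, linarith)
  qed
  finally show ?thesis using contains_pattern_13_2_4_blocks[OF part] by simp
qed

lemma avoider_rgfs_13_2_4: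
  "avoider_rgfs n pattern_13_2_4 = {w. is_rgf w \<and> length w = n \<and> avoids_abac w}"
proof
  show "avoider_rgfs n pattern_13_2_4 \<subseteq> {w. is_rgf w \<and> length w = n \<and> avoids_abac w}"
    using is_rgf_rgf_of contains_pattern_13_2_4_iff
    by (auto simp: avoider_rgfs_def avoiders_def)
  show "{w. is_rgf w \<and> length w = n \<and> avoids_abac w} \<subseteq> avoider_rgfs n pattern_13_2_4"
  proof clarify
    fix w assume w: "is_rgf w" "avoids_abac w" and n: "n = length w"
    obtain \<sigma> where "partition_on {1..length w} \<sigma>" "rgf_of (length w) \<sigma> = w"
      using ex_partition_rgf_of[OF w(1)] by blast
    then show "w \<in> avoider_rgfs (length w) pattern_13_2_4"
      using w contains_pattern_13_2_4_iff by (force simp: avoider_rgfs_def avoiders_def)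
  qed
qed

lemma card_avoiders: "card (avoiders n \<pi>) = card (avoider_rgfs n \<pi>)"
  unfolding avoider_rgfs_def
  by (rule card_image[symmetric], rule inj_on_subset[OF inj_on_rgf_of])
    (auto simp: avoiders_def)

section \<open>Words avoiding abac\<close>

lemma avoids_abacD:
  "avoids_abac w \<Longrightarrow> subseq [a, b, a, c] w \<Longrightarrow> a \<noteq> b \<Longrightarrow> a \<noteq> c \<Longrightarrow> b = c"
  unfolding avoids_abac_def by blast

lemma subseq_set: "subseq xs ys \<Longrightarrow> set xs \<subseteq> set ys"
  by (blast elim: list_emb_set)

text \<open>In a sorted word the larger value cannot precede the smaller one.\<close>

lemma subseq_sorted_pair:
  fixes x y :: "'a :: linorder"
  assumes "sorted u" "x \<in> set u" "y \<in> set u" "x < y"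
  shows "subseq [x, y] u"
proof -
  obtain p q where u: "u = p @ x # q" using split_list[OF assms(2)] by blast
  then have "y \<in> set q" using assms by (auto simp: sorted_append)
  then have "subseq ([] @ [x, y]) (p @ x # q)"
    by (intro list_emb_append_mono) (simp_all add: subseq_singleton_left)
  then show ?thesis using u by simp
qed

lemma sorted_wrt_subseq_pair: "sorted_wrt R u \<Longrightarrow> subseq [x, y] u \<Longrightarrow> R x y"
  by (induction u) (auto simp: subseq_singleton_left split: if_splits)

text \<open>At a descent, the smaller letter also has an occurrence before the larger one.\<close>

lemma rgf_not_sorted:
  assumes "is_rgf u" "\<not> sorted u"
  shows "\<exists>a b. a < b \<and> subseq [a, b, a] u"
  using assms
proof (induction u rule: rev_induct)
  case (snoc x u)
  have u: "is_rgf u" and x: "1 \<le> x" using snoc.prems by (simp_all add: is_rgf_snoc)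
  show ?case
  proof (cases "sorted u")
    case True
    then obtain y where y: "y \<in> set u" "x < y"
      using snoc.prems(2) by (auto simp: sorted_append not_le)
    then have "x \<in> set u" using x mem_rgf[OF u] by auto
    then have "subseq ([x, y] @ [x]) (u @ [x])"
      using subseq_sorted_pair[OF True _ y(1,2)] by (intro list_emb_append_mono) simp_all
    then show ?thesis using y by auto
  next
    case False
    then show ?thesis using snoc.IH[OF u] by (blast intro: subseq_rev_drop_many)
  qed
qed simp

text \<open>As \<open>m\<close> is new after \<open>u\<close>, it exceeds the number of letters of
  \<open>u\<close>, and the growth condition lets it do so only by one.\<close>

lemma rgf_before_max:
  assumes "is_rgf (u @ m # v)" "m \<notin> set u"
  shows "card (set u) = m - 1" "is_rgf u"
proof -
  have r: "is_rgf (u @ [m])" using is_rgf_appendD[of "u @ [m]" v] assms(1) by simp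
  then show u: "is_rgf u" by (rule is_rgf_appendD)
  have "m \<le> Suc (card (set u))" "1 \<le> m" using r by (simp_all add: is_rgf_snoc)
  then show "card (set u) = m - 1" using assms(2) mem_rgf[OF u, of m] by auto
qed

text \<open>Here \<open>v\<close> is the rest of the word after the first occurrence of the largest letter \<open>m\<close>.\<close>

definition good_tails :: "nat \<Rightarrow> nat list set" where
  "good_tails m = {v. set v \<subseteq> {m - 1, m} \<or>
    (\<exists>z a b. 1 \<le> z \<and> z < m - 1 \<and> 1 \<le> b \<and> v = replicate a m @ replicate b z)}"

text \<open>Every letter below \<open>m\<close> occurs in \<open>u\<close>, so each such letter in
  \<open>v\<close> is a repetition across the first \<open>m\<close>. The word \<open>v\<close> is
  cut as \<open>p @ z # q\<close> at its first letter \<open>z\<close> below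
  \<open>m - 1\<close>.\<close>

lemma avoids_abac_tail:
  assumes av: "avoids_abac (u @ m # v)" and u: "sorted u" "set u = {1..m - 1}" and m: "3 \<le> m"
    and v: "set v \<subseteq> {1..m}"
  shows "v \<in> good_tails m"
proof (cases "\<exists>z\<in>set v. z < m - 1")
  case True
  then obtain p z q where pq: "v = p @ z # q" "z < m - 1" "\<forall>y\<in>set p. \<not> y < m - 1"
    using split_list_first_prop[of v "\<lambda>z. z < m - 1"] by blast
  have z: "1 \<le> z" using v pq by auto
  have in_u: "y \<in> set u" if "1 \<le> y" "y < m" for y using that u by auto
  have "y = m" if y: "y \<in> set p" for y
  proof (rule ccontr)
    assume "y \<noteq> m"
    then have "y < m" "1 \<le> y" using y v pq(1) by force+
    \<comment> \<open>A letter \<open>y\<close> of \<open>p\<close> other than \<open>m\<close>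
      completes \<open>y m y z\<close>, its first copy coming from \<open>u\<close>.\<close>
    then have "subseq ([y] @ [m] @ [y] @ [z]) (u @ [m] @ p @ z # q)"
      using y in_u by (intro list_emb_append_mono) (auto simp: subseq_singleton_left)
    then have "y = z" using avoids_abacD[OF av, of y m z] \<open>y < m\<close> pq(1,2)
      by (cases "y = z") auto
    then show False using y pq by auto
  qed
  then have p: "p = replicate (length p) m" by (simp add: replicate_eqI)
  have "y = z" if y: "y \<in> set q" for y
  proof (rule ccontr)
    assume ne: "y \<noteq> z"
    \<comment> \<open>For a letter \<open>y\<close> of \<open>q\<close> other than \<open>z\<close>,
      this occurrence forces \<open>y = m - 1\<close>, while \<open>z m z y\<close> below forces
      \<open>y = m\<close>.\<close>
    have "subseq ([z, m - 1] @ [z] @ [y]) (u @ (m # p @ [z]) @ q)"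
      using subseq_sorted_pair[OF u(1), of z "m - 1"] in_u[of z] in_u[of "m - 1"] z pq(2) y m
      by (intro list_emb_append_mono) (auto simp: subseq_singleton_left)
    then have "m - 1 = y" using avoids_abacD[OF av, of z "m - 1" y] pq ne by auto
    moreover have "subseq ([z] @ [m] @ [z] @ [y]) (u @ [m] @ (p @ [z]) @ q)"
      using in_u[of z] z pq(2) y
      by (intro list_emb_append_mono) (auto simp: subseq_singleton_left)
    then have "m = y" using avoids_abacD[OF av, of z m y] pq ne by auto
    ultimately show False using m by simp
  qed
  then have q: "q = replicate (length q) z" by (simp add: replicate_eqI)
  have "v = replicate (length p) m @ replicate (Suc (length q)) z"
    using pq(1) p q by simp
  then show ?thesis using pq(2) z unfolding good_tails_def
    by (intro CollectI disjI2 exI[of _ z] exI[of _ "length p"] exI[of _ "Suc (length q)"]) simp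
next
  case False
  then have "set v \<subseteq> {m - 1, m}" using v by force
  then show ?thesis by (simp add: good_tails_def)
qed

text \<open>The cases are how much of \<open>abac\<close> lies in the sorted part \<open>u\<close>.
  Here \<open>v\<close> includes the first \<open>m\<close>, so both kinds of tail are covered at
  once.\<close>

lemma avoids_abac_append:
  fixes m :: nat
  assumes u: "sorted u" "\<And>x. x \<in> set u \<Longrightarrow> x < m" and v: "set v \<subseteq> {z, m}"
    and z: "z = m - 1 \<or> (\<exists>a b. v = replicate a m @ replicate b z)" "z < m"
  shows "avoids_abac (u @ v)"
  unfolding avoids_abac_def
proof (intro allI impI)
  fix a b c assume "subseq [a, b, a, c] (u @ v)"
  then obtain s t where st: "[a, b, a, c] = s @ t" "subseq s u" "subseq t v"
    unfolding subseq_append_iff by blast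
  show "a = b \<or> a = c \<or> b = c"
  proof (cases "length s \<ge> 3")
    case True
    \<comment> \<open>Three letters in \<open>u\<close> would make \<open>a b a\<close>
      sorted.\<close>
    then have "subseq [a, b] s" "subseq [b, a] s" using st(1)
      by (auto simp: Cons_eq_append_conv)
    then have "a \<le> b" "b \<le> a" using sorted_wrt_subseq_pair[OF u(1)] st(2) subseq_order.trans by blast+
    then show ?thesis by simp
  next
    case False
    then have ac: "subseq [a, c] t" using st(1) by (auto simp: Cons_eq_append_conv)
    then have acv: "subseq [a, c] v" using st(3) subseq_order.trans by blast
    then have a: "a \<in> {z, m}" and c: "c \<in> {z, m}"
      using v by (auto dest!: subseq_set)
    show ?thesis
    proof (cases "a = m")
      case True
      \<comment> \<open>If \<open>a = m\<close>, nothing of the pattern can lie in \<open>u\<close>,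
        and \<open>v\<close> has only two letters.\<close>
      then have "a \<notin> set u" using u(2) by auto
      then have "s = []" using st by (cases s) (auto dest: subseq_set)
      then have "b \<in> set v" using st by (auto dest!: subseq_set)
      then show ?thesis using v a c by auto
    next
      case am: False
      then have az: "a = z" using a by simp
      show ?thesis
      proof (cases "a = c")
        case False
        then have cm: "c = m" using az c by auto
        \<comment> \<open>Otherwise \<open>v\<close> is weakly decreasing, but \<open>a = z\<close>
          comes before \<open>c = m\<close> in it.\<close>
        have "z = m - 1"
        proof (rule ccontr)
          assume "z \<noteq> m - 1"
          then obtain i j where "v = replicate i m @ replicate j z" using z by blast
          then have "sorted_wrt (\<ge>) v"
            using z(2) by (auto simp: sorted_wrt_iff_nth_less nth_append)
          then have "a \<ge> c" using acv by (rule sorted_wrt_subseq_pair)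
          then show False using cm az z(2) by simp
        qed
        show ?thesis
        proof (cases "length s \<ge> 2")
          case True
          then have "subseq [a, b] s" using st(1) by (auto simp: Cons_eq_append_conv)
          then have ab: "subseq [a, b] u" using st(2) subseq_order.trans by blast
          \<comment> \<open>With \<open>a = m - 1\<close>, a letter \<open>b\<close> of
            \<open>u\<close> after \<open>a\<close> lies between \<open>m - 1\<close> and
            \<open>m\<close>, so it equals \<open>a\<close>.\<close>
          then have "a \<le> b" "b < m" using sorted_wrt_subseq_pair[OF u(1)] u(2) by (auto dest!: subseq_set)
          then show ?thesis using \<open>z = m - 1\<close> az by linarith
        next
          case False
          then have "b \<in> set t" using st(1) by (auto simp: Cons_eq_append_conv)
          then have "b \<in> set v" using st(3) by (auto dest: subseq_set)
          then show ?thesis using v az cm by auto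
        qed
      qed simp
    qed
  qed
qed

lemma avoids_abac_card_le_2: "card (set w) \<le> 2 \<Longrightarrow> avoids_abac w"
  unfolding avoids_abac_def
proof (intro allI impI)
  fix a b c assume w: "card (set w) \<le> 2" and "subseq [a, b, a, c] w"
  then have "{a, b, c} \<subseteq> set w" by (auto dest!: subseq_set)
  then have "card {a, b, c} \<le> 2" using w by (meson List.finite_set card_mono le_trans)
  then show "a = b \<or> a = c \<or> b = c" by (auto simp: card_insert_if split: if_splits)
qed

lemma good_tails_avoids_abac:
  assumes u: "sorted u" "\<And>x. x \<in> set u \<Longrightarrow> x < m" and v: "v \<in> good_tails m" and m: "1 \<le> m"
  shows "avoids_abac (u @ m # v)"
  using v unfolding good_tails_def
proof (elim CollectE disjE exE conjE)
  assume "set v \<subseteq> {m - 1, m}"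
  then show ?thesis using u m by (intro avoids_abac_append[where z = "m - 1"]) auto
next
  fix z a b assume z: "z < m - 1" and v: "v = replicate a m @ replicate b z"
  have "m # v = replicate (Suc a) m @ replicate b z" using v by simp
  then have "\<exists>a b. m # v = replicate a m @ replicate b z" by blast
  then show ?thesis
    by (intro avoids_abac_append[where z = z and m = m]) (use u v z in auto)
qed

lemma avoids_abac_iff:
  assumes w: "is_rgf w" and m: "card (set w) = m" "3 \<le> m"
  shows "avoids_abac w \<longleftrightarrow>
    (\<exists>u v. w = u @ m # v \<and> is_rgf u \<and> sorted u \<and> card (set u) = m - 1 \<and> v \<in> good_tails m)"
proof
  assume av: "avoids_abac w"
  have "m \<in> set w" using m mem_rgf[OF w] by simp
  then obtain u v where uv: "w = u @ m # v" "m \<notin> set u" by (blast dest: split_list_first)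
  have u: "card (set u) = m - 1" "is_rgf u" using rgf_before_max[of u m v] w uv m(1) by simp_all
  have su: "set u = {1..m - 1}" using set_rgf[OF u(2)] u(1) by simp
  have "sorted u"
  proof (rule ccontr)
    assume "\<not> sorted u"
    then obtain a b where ab: "a < b" "subseq [a, b, a] u" using rgf_not_sorted u(2) by blast
    \<comment> \<open>The first \<open>m\<close> plays the role of \<open>c\<close>.\<close>
    then have "subseq ([a, b, a] @ [m]) (u @ m # v)"
      by (intro list_emb_append_mono) simp_all
    moreover have "a < m" "b < m" using ab su by (auto dest!: subseq_set)
    ultimately show False using avoids_abacD[OF av, of a b m] uv(1) ab(1) by simp
  qed
  moreover have "set v \<subseteq> {1..m}" using set_rgf[OF w] unfolding uv(1) m(1)[unfolded uv(1)] by auto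
  ultimately have "v \<in> good_tails m"
    using avoids_abac_tail[of u m v] av uv(1) su m(2) by simp
  then show "\<exists>u v. w = u @ m # v \<and> is_rgf u \<and> sorted u \<and> card (set u) = m - 1 \<and> v \<in> good_tails m"
    using uv(1) u \<open>sorted u\<close> by blast
next
  assume "\<exists>u v. w = u @ m # v \<and> is_rgf u \<and> sorted u \<and> card (set u) = m - 1 \<and> v \<in> good_tails m"
  then obtain u v where *: "w = u @ m # v" "is_rgf u" "sorted u" "card (set u) = m - 1"
    "v \<in> good_tails m" by blast
  then have "x < m" if "x \<in> set u" for x using that mem_rgf[of u x] m(2) by auto
  then show "avoids_abac w" using * m(2) by (simp add: good_tails_avoids_abac)
qed

text \<open>This passes from \<open>good_tails\<close> to the stated cases: the largest letter
  replaces the number of letters, and \<open>v\<close> now includes the first \<open>m\<close>,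
  which lengthens the block of \<open>m\<close> by one.\<close>

lemma avoids_abac_iff_shape:
  assumes w: "is_rgf w" "w \<noteq> []"
  shows "avoids_abac w \<longleftrightarrow>
    (let m = Max (set w) in
        m \<le> 2 \<or>
        (m \<ge> 3 \<and> (\<exists>u v. w = u @ v \<and> sorted u \<and> m \<notin> set u \<and> v \<noteq> [] \<and> hd v = m \<and>
            set v \<subseteq> {m - 1, m})) \<or>
        (m \<ge> 3 \<and> (\<exists>u v. w = u @ v \<and> sorted u \<and> m \<notin> set u \<and> v \<noteq> [] \<and> hd v = m \<and>
            (\<exists>z a b. z < m - 1 \<and> a \<ge> 1 \<and> b \<ge> 1 \<and> v = replicate a m @ replicate b z))))"
proof -
  define m where "m = card (set w)"
  have Max: "Max (set w) = m" using Max_rgf[OF w] by (simp add: m_def)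
  let ?B = "\<exists>u v. w = u @ v \<and> sorted u \<and> m \<notin> set u \<and> v \<noteq> [] \<and> hd v = m \<and> set v \<subseteq> {m - 1, m}"
  let ?C = "\<exists>u v. w = u @ v \<and> sorted u \<and> m \<notin> set u \<and> v \<noteq> [] \<and> hd v = m \<and>
            (\<exists>z a b. z < m - 1 \<and> a \<ge> 1 \<and> b \<ge> 1 \<and> v = replicate a m @ replicate b z)"
  have "avoids_abac w \<longleftrightarrow> m \<le> 2 \<or> (m \<ge> 3 \<and> ?B) \<or> (m \<ge> 3 \<and> ?C)"
  proof (cases "m \<le> 2")
    case True
    then show ?thesis using avoids_abac_card_le_2[of w] by (simp add: m_def)
  next
    case False
    then have m: "3 \<le> m" by simp
    have "avoids_abac w \<longleftrightarrow> ?B \<or> ?C"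
    proof
      assume "avoids_abac w"
      then obtain u v where uv: "w = u @ m # v" "is_rgf u" "sorted u" "card (set u) = m - 1"
        "v \<in> good_tails m"
        using avoids_abac_iff[OF w(1) m_def[symmetric] m] by blast
      have mu: "m \<notin> set u" using mem_rgf[OF uv(2)] uv(4) m by simp
      show "?B \<or> ?C"
      proof (cases "set v \<subseteq> {m - 1, m}")
        case True
        then have ?B using uv mu by (intro exI[of _ u] exI[of _ "m # v"]) simp
        then show ?thesis ..
      next
        case False
        then obtain z a b where *: "z < m - 1" "1 \<le> b" "v = replicate a m @ replicate b z"
          using uv(5) by (auto simp: good_tails_def)
        then have "m # v = replicate (Suc a) m @ replicate b z" by simp
        then have "\<exists>z a b. z < m - 1 \<and> a \<ge> 1 \<and> b \<ge> 1 \<and> m # v = replicate a m @ replicate b z"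
          using * by (metis le_add1 plus_1_eq_Suc)
        then have ?C using uv mu by (intro exI[of _ u] exI[of _ "m # v"]) simp
        then show ?thesis ..
      qed
    next
      assume BC: "?B \<or> ?C"
      obtain u v where uv: "w = u @ m # v" "sorted u" "m \<notin> set u"
        and v: "set v \<subseteq> {m - 1, m} \<or>
          (\<exists>z a b. z < m - 1 \<and> a \<ge> 1 \<and> b \<ge> 1 \<and> m # v = replicate a m @ replicate b z)"
        using BC
      proof (elim disjE exE conjE)
        fix u v assume "w = u @ v" "sorted u" "m \<notin> set u" "v \<noteq> []" "hd v = m" "set v \<subseteq> {m - 1, m}"
        moreover from this have "m # tl v = v" by (metis list.collapse)
        ultimately show thesis by (intro that[of u "tl v"]) (auto dest: list.set_sel(2))
      next
        fix u v z a b assume "w = u @ v" "sorted u" "m \<notin> set u" "v \<noteq> []" "hd v = m" "z < m - 1"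
          "a \<ge> 1" "b \<ge> 1" "v = replicate a m @ replicate b z"
        moreover from this have mv: "m # tl v = v" by (metis list.collapse)
        ultimately have "\<exists>z a b. z < m - 1 \<and> a \<ge> 1 \<and> b \<ge> 1 \<and>
            m # tl v = replicate a m @ replicate b z"
          unfolding mv by (intro exI conjI)
        moreover have "w = u @ m # tl v" using \<open>w = u @ v\<close> mv by simp
        ultimately show thesis using that \<open>sorted u\<close> \<open>m \<notin> set u\<close> by blast
      qed
      have "v \<in> good_tails m"
        using v
      proof (elim disjE exE conjE)
        fix z a b assume *: "z < m - 1" "a \<ge> 1" "b \<ge> 1" "m # v = replicate a m @ replicate b z"
        then have "v = replicate (a - 1) m @ replicate b z" by (cases a) auto
        \<comment> \<open>The block of \<open>z\<close> is nonempty, so \<open>z\<close> is a letter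
          of \<open>w\<close> and therefore positive, as \<open>good_tails\<close> demands.\<close>
        moreover from this have "z \<in> set w" using *(3) uv(1) by simp
        then have "1 \<le> z" using mem_rgf[OF w(1)] by simp
        ultimately show ?thesis using * unfolding good_tails_def by blast
      qed (simp add: good_tails_def)
      then show "avoids_abac w"
        using avoids_abac_iff[OF w(1) m_def[symmetric] m] uv rgf_before_max[of u m v] w(1) by blast
    qed
    then show ?thesis using m by simp
  qed
  then show ?thesis by (simp only: Let_def Max)
qed

section \<open>Counting\<close>

text \<open>These words \<open>1..1 2..2 ... m..m\<close> encode the compositions of
  \<open>k\<close> into \<open>m\<close> positive parts.\<close>

definition sorted_rgfs :: "nat \<Rightarrow> nat \<Rightarrow> nat list set" where
  "sorted_rgfs k m = {u. is_rgf u \<and> length u = k \<and> sorted u \<and> card (set u) = m}"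

lemma finite_rgfs: "finite {w. is_rgf w \<and> length w = n}"
proof (rule finite_subset)
  show "{w. is_rgf w \<and> length w = n} \<subseteq> {w. set w \<subseteq> {1..n} \<and> length w = n}"
  proof
    fix w assume "w \<in> {w. is_rgf w \<and> length w = n}"
    then have w: "is_rgf w" "length w = n" by simp_all
    have "set w = {1..card (set w)}" by (rule set_rgf[OF w(1)])
    also have "\<dots> \<subseteq> {1..n}" using card_length[of w] w(2) by simp
    finally show "w \<in> {w. set w \<subseteq> {1..n} \<and> length w = n}" using w(2) by simp
  qed
qed (simp add: finite_lists_length_eq)

lemma finite_sorted_rgfs: "finite (sorted_rgfs k m)"
  by (rule finite_subset[OF _ finite_rgfs[of k]]) (auto simp: sorted_rgfs_def)

lemma sorted_rgfs_Suc_0: "sorted_rgfs (Suc k) 0 = {}"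
  by (auto simp: sorted_rgfs_def)

lemma sorted_rgfs_0_Suc: "sorted_rgfs 0 (Suc m) = {}"
  by (auto simp: sorted_rgfs_def)

text \<open>The last letter of such a word is its largest; deleting it either keeps that letter in
  use or loses it. Counting both cases gives Pascal's rule.\<close>

lemma sorted_rgfs_Suc:
  assumes "1 \<le> k"
  shows "sorted_rgfs (Suc k) (Suc m) = (\<lambda>u. u @ [Suc m]) ` (sorted_rgfs k (Suc m) \<union> sorted_rgfs k m)"
proof
  show "sorted_rgfs (Suc k) (Suc m) \<subseteq> (\<lambda>u. u @ [Suc m]) ` (sorted_rgfs k (Suc m) \<union> sorted_rgfs k m)"
  proof
    fix w assume w: "w \<in> sorted_rgfs (Suc k) (Suc m)"
    then obtain u x where ux: "w = u @ [x]" by (cases w rule: rev_exhaust) (auto simp: sorted_rgfs_def)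
    have r: "is_rgf w" "sorted w" "card (set w) = Suc m" "length w = Suc k"
      using w by (auto simp: sorted_rgfs_def)
    have "Suc m \<in> set w" "x \<in> set w" using mem_rgf[OF r(1)] r(3) ux by simp_all
    then have x: "x = Suc m"
      using r(2,3) mem_rgf[OF r(1), of x] ux by (auto simp: sorted_append)
    have "card (set u) = Suc m \<or> card (set u) = m"
      using r(3) ux by (auto simp: card_insert_if split: if_splits)
    then have "u \<in> sorted_rgfs k (Suc m) \<union> sorted_rgfs k m"
      using r ux by (auto simp: sorted_rgfs_def is_rgf_snoc sorted_append)
    then show "w \<in> (\<lambda>u. u @ [Suc m]) ` (sorted_rgfs k (Suc m) \<union> sorted_rgfs k m)"
      using ux x by blast
  qed
  show "(\<lambda>u. u @ [Suc m]) ` (sorted_rgfs k (Suc m) \<union> sorted_rgfs k m) \<subseteq> sorted_rgfs (Suc k) (Suc m)"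
  proof clarify
    fix u assume "u \<in> sorted_rgfs k (Suc m) \<union> sorted_rgfs k m"
    then have u: "is_rgf u" "length u = k" "sorted u" "card (set u) = Suc m \<or> card (set u) = m"
      by (auto simp: sorted_rgfs_def)
    then have "card (set (u @ [Suc m])) = Suc m" by (auto simp: card_insert_if mem_rgf)
    then show "u @ [Suc m] \<in> sorted_rgfs (Suc k) (Suc m)"
      using u by (auto simp: sorted_rgfs_def is_rgf_snoc sorted_append mem_rgf)
  qed
qed

lemma card_sorted_rgfs: "card (sorted_rgfs (Suc k) (Suc m)) = k choose m"
proof (induction k arbitrary: m)
  case 0
  have one: "is_rgf [x] \<longleftrightarrow> x = 1" for x using is_rgf_snoc[of "[]" x] by auto
  have "sorted_rgfs (Suc 0) (Suc m) = (if m = 0 then {[1]} else {})"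
    by (auto simp: sorted_rgfs_def length_Suc_conv one)
  then show ?case by simp
next
  case (Suc k)
  have "card (sorted_rgfs (Suc (Suc k)) (Suc m)) =
      card (sorted_rgfs (Suc k) (Suc m) \<union> sorted_rgfs (Suc k) m)"
    by (subst sorted_rgfs_Suc) (auto intro!: card_image inj_onI)
  also have "\<dots> = card (sorted_rgfs (Suc k) (Suc m)) + card (sorted_rgfs (Suc k) m)"
    by (intro card_Un_disjoint finite_sorted_rgfs) (auto simp: sorted_rgfs_def)
  also have "\<dots> = Suc k choose m"
    by (cases m) (simp_all add: Suc.IH sorted_rgfs_Suc_0)
  finally show ?case .
qed

text \<open>There are \<open>2 ^ N\<close> words over \<open>m - 1\<close> and \<open>m\<close>. A
  tail of the other kind is fixed by its letter \<open>z\<close>, with \<open>m - 2\<close> choices,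
  and the length of its final block, with \<open>N\<close> choices.\<close>

lemma card_good_tails:
  assumes "2 \<le> m"
  shows "finite {v \<in> good_tails m. length v = N}"
    "card {v \<in> good_tails m. length v = N} = 2 ^ N + (m - 2) * N"
proof -
  let ?f = "\<lambda>(z, b). replicate (N - b) m @ replicate b z"
  let ?B = "{v. set v \<subseteq> {m - 1, m} \<and> length v = N}"
  let ?C = "?f ` ({1..m - 2} \<times> {1..N})"
  have split: "{v \<in> good_tails m. length v = N} = ?B \<union> ?C"
  proof
    show "{v \<in> good_tails m. length v = N} \<subseteq> ?B \<union> ?C"
    proof
      fix v assume "v \<in> {v \<in> good_tails m. length v = N}"
      then have v: "v \<in> good_tails m" "length v = N" by simp_all
      show "v \<in> ?B \<union> ?C"
      proof (cases "set v \<subseteq> {m - 1, m}")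
        case True
        then show ?thesis using v by simp
      next
        case False
        then obtain z a b where *: "1 \<le> z" "z < m - 1" "1 \<le> b" "v = replicate a m @ replicate b z"
          using v(1) by (auto simp: good_tails_def)
        then have "v = ?f (z, b)" using v(2) by auto
        moreover have "(z, b) \<in> {1..m - 2} \<times> {1..N}" using * v(2) by auto
        ultimately show ?thesis by blast
      qed
    qed
    show "?B \<union> ?C \<subseteq> {v \<in> good_tails m. length v = N}"
    proof
      fix v assume "v \<in> ?B \<union> ?C"
      then show "v \<in> {v \<in> good_tails m. length v = N}"
      proof
        assume "v \<in> ?C"
        then obtain z b where "1 \<le> z" "z \<le> m - 2" "1 \<le> b" "b \<le> N"
          "v = replicate (N - b) m @ replicate b z" by auto
        moreover from this have "z < m - 1" by linarith
        ultimately show ?thesis unfolding good_tails_def by auto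
      qed (auto simp: good_tails_def)
    qed
  qed
  have finB: "finite ?B" by (rule finite_lists_length_eq) simp
  show "finite {v \<in> good_tails m. length v = N}" unfolding split using finB by simp
  have "inj_on ?f ({1..m - 2} \<times> {1..N})"
  proof (rule inj_onI, clarify)
    fix z b z' b'
    assume *: "z \<in> {1..m - 2}" "b \<in> {1..N}" "z' \<in> {1..m - 2}" "b' \<in> {1..N}"
      and eq: "replicate (N - b) m @ replicate b z = replicate (N - b') m @ replicate b' z'"
    \<comment> \<open>Deleting the letters \<open>m\<close> leaves the nonempty block of
      \<open>z\<close>, which reveals both parameters.\<close>
    have "filter (\<lambda>x. x \<noteq> m) (replicate (N - b) m @ replicate b z) = replicate b z"
      "filter (\<lambda>x. x \<noteq> m) (replicate (N - b') m @ replicate b' z') = replicate b' z'"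
      using * assms by auto
    then have "replicate b z = replicate b' z'" using eq by simp
    then show "z = z' \<and> b = b'" using * by (auto simp: replicate_eq_replicate)
  qed
  then have "card ?C = (m - 2) * N" by (simp add: card_image card_cartesian_product)
  moreover have "card ?B = 2 ^ N"
  proof -
    have "card {m - 1, m} = 2" using assms by simp
    then show ?thesis using card_lists_length_eq[of "{m - 1, m}" N] by simp
  qed
  \<comment> \<open>A word in \<open>?C\<close> really contains its letter \<open>z\<close>, because
    the final block has length at least one.\<close>
  moreover have "?B \<inter> ?C = {}" by force
  ultimately show "card {v \<in> good_tails m. length v = N} = 2 ^ N + (m - 2) * N"
    unfolding split by (subst card_Un_disjoint[OF finB]) simp_all
qed

section \<open>Avoiding words with a given largest letter\<close>

lemma avoiders_max_eq:
  assumes "3 \<le> m"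
  shows "{w. is_rgf w \<and> length w = n \<and> avoids_abac w \<and> card (set w) = m} =
    (\<lambda>(u, v). u @ m # v) `
      (\<Union>k<n. sorted_rgfs k (m - 1) \<times> {v \<in> good_tails m. length v = n - 1 - k})"
  (is "?L = ?f ` ?P")
proof
  show "?L \<subseteq> ?f ` ?P"
  proof
    fix w assume "w \<in> ?L"
    then have w: "is_rgf w" "avoids_abac w" "card (set w) = m" "length w = n" by simp_all
    then obtain u v where uv: "w = u @ m # v" "is_rgf u" "sorted u" "card (set u) = m - 1"
      "v \<in> good_tails m"
      using avoids_abac_iff[OF w(1,3) assms] by blast
    have "length u < n" "length v = n - 1 - length u" using w(4) uv(1) by auto
    then have "(u, v) \<in> ?P" using uv by (auto simp: sorted_rgfs_def)
    then show "w \<in> ?f ` ?P" using uv(1) by force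
  qed
  show "?f ` ?P \<subseteq> ?L"
  proof
    fix w assume "w \<in> ?f ` ?P"
    then obtain u v where uv: "w = u @ m # v" "is_rgf u" "sorted u" "card (set u) = m - 1"
      "v \<in> good_tails m" "length w = n"
      by (auto simp: sorted_rgfs_def)
    have um: "is_rgf (u @ [m])" using uv assms by (simp add: is_rgf_snoc)
    have "m \<notin> set u" using uv mem_rgf[of u m] assms by auto
    then have cum: "card (set (u @ [m])) = m" using uv assms by simp
    have v: "set v \<subseteq> {1..m}"
      using uv(5) assms by (auto simp: good_tails_def)
    then have "is_rgf ((u @ [m]) @ v)" by (intro is_rgf_appendI[OF um]) (simp only: cum)
    then have w: "is_rgf w" using uv(1) by simp
    have "set w = {1..m}" using set_rgf[OF um] v unfolding cum uv(1) by auto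
    then have "card (set w) = m" by simp
    then show "w \<in> ?L" using w uv avoids_abac_iff[OF w _ assms] by blast
  qed
qed

lemma card_avoiders_max_eq:
  assumes "3 \<le> m"
  shows "card {w. is_rgf w \<and> length w = n \<and> avoids_abac w \<and> card (set w) = m} =
    (\<Sum>k<n. card (sorted_rgfs k (m - 1)) * (2 ^ (n - 1 - k) + (m - 2) * (n - 1 - k)))"
proof -
  let ?S = "\<lambda>k. sorted_rgfs k (m - 1)" and ?T = "\<lambda>k. {v \<in> good_tails m. length v = n - 1 - k}"
  \<comment> \<open>The pair is recovered from the word, since \<open>u\<close> is the longest
    prefix free of \<open>m\<close>.\<close>
  have prefix: "takeWhile (\<lambda>x. x \<noteq> m) (u @ m # v) = u" if "m \<notin> set u" for u v
    using that by (subst takeWhile_append2) auto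
  have "inj_on (\<lambda>(u, v). u @ m # v) (\<Union>k<n. ?S k \<times> ?T k)"
  proof (rule inj_onI, clarify)
    fix u v u' v' k k'
    assume "u \<in> ?S k" "u' \<in> ?S k'" and eq: "u @ m # v = u' @ m # v'"
    then have "m \<notin> set u" "m \<notin> set u'" using mem_rgf assms by (auto simp: sorted_rgfs_def)
    then show "u = u' \<and> v = v'" using prefix[of u v] prefix[of u' v'] eq by simp
  qed
  then have "card {w. is_rgf w \<and> length w = n \<and> avoids_abac w \<and> card (set w) = m} =
      card (\<Union>k<n. ?S k \<times> ?T k)"
    unfolding avoiders_max_eq[OF assms] by (rule card_image)
  also have "\<dots> = (\<Sum>k<n. card (?S k \<times> ?T k))"
    using assms
    by (intro card_UN_disjoint ballI impI finite_cartesian_product finite_sorted_rgfs card_good_tails)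
      (auto simp: sorted_rgfs_def)
  finally show ?thesis using assms by (simp add: card_cartesian_product card_good_tails)
qed

text \<open>From each tail count a 1 is split off for the tail consisting of \<open>m\<close> only;
  these ones sum to the single binomial coefficient. The lower index is \<open>k + 1 - m\<close>
  since \<open>k - m + 1\<close> would truncate to 1 at \<open>k = m - 1\<close>.\<close>

lemma card_avoiders_max_eq_binomial:
  assumes "3 \<le> m" "m \<le> n"
  shows "card {w. is_rgf w \<and> length w = n \<and> avoids_abac w \<and> card (set w) = m} =
    ((n - 1) choose (n - m)) + (\<Sum>k = m - 1..n - 2.
        ((k - 1) choose (k + 1 - m)) * ((2 ^ (n - k - 1) - 1) + (m - 2) * (n - k - 1)))"
proof -
  \<comment> \<open>Writing \<open>m = p + 3\<close> and \<open>n = N + 2\<close> removes most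
    truncated subtractions.\<close>
  obtain p where p: "m = Suc (Suc (Suc p))"
    using assms(1) by (metis Suc_le_D numeral_3_eq_3 Suc_le_mono)
  obtain N where "n = 2 + N" using assms le_Suc_ex[of 2 n] by auto
  then have N: "n = Suc (Suc N)" by simp
  let ?r = "\<lambda>k. (2 ^ (N - k) - 1) + (p + 1) * (N - k)"
  have "card {w. is_rgf w \<and> length w = n \<and> avoids_abac w \<and> card (set w) = m} =
      (\<Sum>k<Suc N. (k choose Suc p) * (2 ^ (N - k) + (p + 1) * (N - k)))"
  proof -
    have "card {w. is_rgf w \<and> length w = n \<and> avoids_abac w \<and> card (set w) = m} =
        (\<Sum>k<Suc (Suc N). card (sorted_rgfs k (Suc (Suc p))) *
          (2 ^ (Suc N - k) + (p + 1) * (Suc N - k)))"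
      unfolding card_avoiders_max_eq[OF assms(1)] by (simp add: p N del: sum.lessThan_Suc)
    also have "\<dots> = (\<Sum>k<Suc N. card (sorted_rgfs (Suc k) (Suc (Suc p))) *
          (2 ^ (N - k) + (p + 1) * (N - k)))"
      \<comment> \<open>The term for the empty \<open>u\<close> vanishes, and the shift makes
        lengths successors, as \<open>card_sorted_rgfs\<close> expects.\<close>
      by (subst sum.lessThan_Suc_shift) (simp only: sorted_rgfs_0_Suc card.empty mult_0 add_0 diff_Suc_Suc)
    finally show ?thesis by (simp only: card_sorted_rgfs)
  qed
  also have "\<dots> = (\<Sum>k<Suc N. (k choose Suc p) + (k choose Suc p) * ?r k)"
  proof (rule sum.cong)
    fix k
    have "(2::nat) ^ (N - k) + (p + 1) * (N - k) = 1 + ?r k" by simp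
    then show "(k choose Suc p) * (2 ^ (N - k) + (p + 1) * (N - k)) =
      (k choose Suc p) + (k choose Suc p) * ?r k"
      by (simp only: distrib_left mult_1_right)
  qed simp
  also have "\<dots> = (\<Sum>k<Suc N. k choose Suc p) + (\<Sum>k<Suc N. (k choose Suc p) * ?r k)"
    by (rule sum.distrib)
  also have "(\<Sum>k<Suc N. k choose Suc p) = (n - 1) choose (n - m)"
  proof -
    have "(\<Sum>k<Suc N. k choose Suc p) = Suc N choose Suc (Suc p)"
      using sum_choose_upper[of "Suc p" N] by (simp add: lessThan_Suc_atMost atMost_atLeast0)
    also have "\<dots> = Suc N choose (Suc N - Suc (Suc p))"
      using assms by (intro binomial_symmetric) (simp add: p N)
    finally show ?thesis by (simp add: p N)
  qed
  also have "(\<Sum>k<Suc N. (k choose Suc p) * ?r k) = (\<Sum>k = Suc p..<N. (k choose Suc p) * ?r k)"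
  proof (rule sum.mono_neutral_right)
    \<comment> \<open>Below \<open>Suc p\<close> the binomial coefficient is zero; at
      \<open>k = N\<close> the tail is empty and the bracket is zero.\<close>
    show "\<forall>k\<in>{..<Suc N} - {Suc p..<N}. (k choose Suc p) * ?r k = 0"
    proof
      fix k assume "k \<in> {..<Suc N} - {Suc p..<N}"
      then have "k < Suc p \<or> k = N" by auto
      then show "(k choose Suc p) * ?r k = 0" by (auto simp: binomial_eq_0)
    qed
  qed auto
  also have "\<dots> = (\<Sum>k = m - 1..n - 2.
      ((k - 1) choose (k + 1 - m)) * ((2 ^ (n - k - 1) - 1) + (m - 2) * (n - k - 1)))"
  \<comment> \<open>Back to the length of \<open>u\<close> as the index, which is
    \<open>Suc k\<close>.\<close>
  proof (rule sum.reindex_bij_witness[of _ "\<lambda>k. k - 1" Suc])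
    fix k assume k: "k \<in> {Suc p..<N}"
    then have "k choose Suc p = k choose (k - Suc p)" by (intro binomial_symmetric) simp
    then show "(Suc k - 1 choose (Suc k + 1 - m)) *
         (2 ^ (n - Suc k - 1) - 1 + (m - 2) * (n - Suc k - 1)) = (k choose Suc p) * ?r k"
      by (simp add: p N)
  qed (auto simp: p N)
  finally show ?thesis .
qed

section \<open>Words with at most two letters, and the total count\<close>

text \<open>After the initial 1, the letters 1 and 2 can be chosen freely.\<close>

lemma rgfs_card_le_2:
  assumes "1 \<le> n"
  shows "{w. is_rgf w \<and> length w = n \<and> card (set w) \<le> 2} =
    (#) 1 ` {v. set v \<subseteq> {1, 2} \<and> length v = n - 1}"
proof
  show "{w. is_rgf w \<and> length w = n \<and> card (set w) \<le> 2} \<subseteq>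
    (#) 1 ` {v. set v \<subseteq> {1, 2} \<and> length v = n - 1}"
  proof
    fix w assume "w \<in> {w. is_rgf w \<and> length w = n \<and> card (set w) \<le> 2}"
    then have w: "is_rgf w" "length w = n" "card (set w) \<le> 2" by auto
    then obtain x v where xv: "w = x # v" using assms by (cases w) auto
    have "x = 1" using w(1) by (simp add: is_rgf_def xv)
    moreover have "set v \<subseteq> {1, 2}" 
    proof
      fix y assume "y \<in> set v"
      then have "1 \<le> y \<and> y \<le> 2" using mem_rgf[OF w(1), of y] w(3) xv by auto
      then show "y \<in> {1, 2}" by auto
    qed
    ultimately show "w \<in> (#) 1 ` {v. set v \<subseteq> {1, 2} \<and> length v = n - 1}" using xv w(2) by auto
  qed
  have "is_rgf (1 # v)" if "set v \<subseteq> {1, 2}" for v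
    using that
  proof (induction v rule: rev_induct)
    case Nil
    then show ?case using is_rgf_snoc[of "[]" 1] by simp
  next
    case (snoc x v)
    have "card (set (1 # v)) > 0" by (simp add: card_gt_0_iff del: set_simps)
    then show ?case using snoc is_rgf_snoc[of "1 # v" x] by auto
  qed
  moreover have "card (set (1 # v)) \<le> 2" if "set v \<subseteq> {1, 2::nat}" for v
    using card_mono[of "{1, 2}" "set (1 # v)"] that by simp
  ultimately show "(#) 1 ` {v. set v \<subseteq> {1, 2} \<and> length v = n - 1} \<subseteq>
    {w. is_rgf w \<and> length w = n \<and> card (set w) \<le> 2}"
    using assms by auto
qed

lemma card_avoids_abac:
  assumes "1 \<le> n"
  shows "card {w. is_rgf w \<and> length w = n \<and> avoids_abac w} =
      2 ^ (n - 1) + (\<Sum>m = 3..n. (n - 1) choose (n - m)) +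
      (\<Sum>m = 3..n - 1. \<Sum>k = m - 1..n - 2.
        ((k - 1) choose (k + 1 - m)) * ((2 ^ (n - k - 1) - 1) + (m - 2) * (n - k - 1)))"
    (is "_ = _ + _ + (\<Sum>m = 3..n - 1. ?g m)")
proof -
  let ?W = "\<lambda>m. {w. is_rgf w \<and> length w = n \<and> avoids_abac w \<and> card (set w) = m}"
  let ?V = "{w. is_rgf w \<and> length w = n \<and> card (set w) \<le> 2}"
  have split: "{w. is_rgf w \<and> length w = n \<and> avoids_abac w} = ?V \<union> (\<Union>m\<in>{3..n}. ?W m)"
  proof
    show "?V \<union> (\<Union>m\<in>{3..n}. ?W m) \<subseteq> {w. is_rgf w \<and> length w = n \<and> avoids_abac w}"
      using avoids_abac_card_le_2 by auto
    show "{w. is_rgf w \<and> length w = n \<and> avoids_abac w} \<subseteq> ?V \<union> (\<Union>m\<in>{3..n}. ?W m)"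
    proof
      fix w assume w: "w \<in> {w. is_rgf w \<and> length w = n \<and> avoids_abac w}"
      then have "card (set w) \<le> n" using card_length[of w] by auto
      then show "w \<in> ?V \<union> (\<Union>m\<in>{3..n}. ?W m)" using w by (cases "card (set w) \<le> 2") auto
    qed
  qed
  have fin: "finite ?V" "finite (?W m)" for m
    by (rule finite_subset[OF _ finite_rgfs[of n]]; auto)+
  have "card ?V = 2 ^ (n - 1)"
    unfolding rgfs_card_le_2[OF assms]
    using card_lists_length_eq[of "{1, 2::nat}" "n - 1"] by (simp add: card_image numeral_2_eq_2)
  moreover have "card (\<Union>m\<in>{3..n}. ?W m) = (\<Sum>m = 3..n. card (?W m))"
    using fin(2) by (intro card_UN_disjoint) auto
  moreover have "(\<Sum>m = 3..n. card (?W m)) = (\<Sum>m = 3..n. ((n - 1) choose (n - m)) + ?g m)"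
    by (intro sum.cong refl card_avoiders_max_eq_binomial) auto
  \<comment> \<open>At \<open>m = n\<close> the inner range runs from \<open>n - 1\<close> to
    \<open>n - 2\<close> and is empty.\<close>
  moreover have "(\<Sum>m = 3..n. ?g m) = (\<Sum>m = 3..n - 1. ?g m)"
  proof (rule sum.mono_neutral_right)
    show "\<forall>m\<in>{3..n} - {3..n - 1}. ?g m = 0"
    proof
      fix m assume "m \<in> {3..n} - {3..n - 1}"
      then have "{m - 1..n - 2} = {}" by auto
      then show "?g m = 0" by (simp only: sum.empty)
    qed
  qed auto
  moreover have "?V \<inter> (\<Union>m\<in>{3..n}. ?W m) = {}" by auto
  ultimately show ?thesis
    unfolding split using fin by (subst card_Un_disjoint) (simp_all add: sum.distrib)
qed

theorem theorem3p9:
  fixes n :: nat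
  assumes "n \<ge> 1"
  shows "(avoider_rgfs n pattern_13_2_4 =
    {w. is_rgf w \<and> length w = n \<and>
      (let m = Max (set w) in
        m \<le> 2 \<or>
        (m \<ge> 3 \<and> (\<exists>u v. w = u @ v \<and> sorted u \<and> m \<notin> set u \<and> v \<noteq> [] \<and> hd v = m \<and>
            set v \<subseteq> {m - 1, m})) \<or>
        (m \<ge> 3 \<and> (\<exists>u v. w = u @ v \<and> sorted u \<and> m \<notin> set u \<and> v \<noteq> [] \<and> hd v = m \<and>
            (\<exists>z a b. z < m - 1 \<and> a \<ge> 1 \<and> b \<ge> 1 \<and> v = replicate a m @ replicate b z))))}) \<and>
    (card (avoiders n pattern_13_2_4) =
      2 ^ (n - 1) + (\<Sum>m = 3..n. (n - 1) choose (n - m)) +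
      (\<Sum>m = 3..n - 1. \<Sum>k = m - 1..n - 2.
        ((k - 1) choose (k + 1 - m)) * ((2 ^ (n - k - 1) - 1) + (m - 2) * (n - k - 1))))"
proof (rule conjI)
  \<comment> \<open>Nonemptiness gives \<open>Max (set w)\<close> its meaning as the largest
    letter.\<close>
  have "w \<noteq> []" if "length w = n" for w :: "nat list" using that assms by auto
  then show "avoider_rgfs n pattern_13_2_4 =
    {w. is_rgf w \<and> length w = n \<and>
      (let m = Max (set w) in
        m \<le> 2 \<or>
        (m \<ge> 3 \<and> (\<exists>u v. w = u @ v \<and> sorted u \<and> m \<notin> set u \<and> v \<noteq> [] \<and> hd v = m \<and>
            set v \<subseteq> {m - 1, m})) \<or>
        (m \<ge> 3 \<and> (\<exists>u v. w = u @ v \<and> sorted u \<and> m \<notin> set u \<and> v \<noteq> [] \<and> hd v = m \<and>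
            (\<exists>z a b. z < m - 1 \<and> a \<ge> 1 \<and> b \<ge> 1 \<and> v = replicate a m @ replicate b z))))}"
    unfolding avoider_rgfs_13_2_4
    by (intro Collect_cong conj_cong refl avoids_abac_iff_shape) simp_all
qed (simp only: card_avoiders avoider_rgfs_13_2_4 card_avoids_abac[OF assms])

end
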